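(* Let $\mathcal{E}=\{(X,\mathcal{A},\mu);\ \mathbb{R}^n_+;\ e;\ \{\succ_a\}_{a\in X}\}$ be a pure exchange economy satisfying (E1)–(E3) of the context, with preferences of the following form: there are subsets $J_1,\dots,J_r\subseteq\{1,\dots,n\}$ with $\bigcap_{i=1}^rJ_i\ne\emptyset$ such that, for every $k\le r$, every $a\in E_k$ and all $x,y\in\mathbb{R}^n_+$, $x\succ_a y$ if and only if $x_j>y_j$ for all $j\in J_k$. Then $e\in W(\mathcal{E})$.
   Context: Fuzzy measures. A fuzzy measure on a measurable space $(X,\mathcal{A})$ ($\mathcal{A}$ a $\sigma$-algebra) is a map $\mu:\mathcal{A}\to[0,\infty)$ with $\mu(\emptyset)=0$, $\mu(X)<\infty$ and $\mu(A)\le\mu(B)$ whenever $A\subset B$. It is submodular if $\mu(A\cup B)+\mu(A\cap B)\le\mu(A)+\mu(B)$ for all $A,B\in\mathcal{A}$. It is semiconvex if for every $E\in\mathcal{A}$ there is $F\in\mathcal{A}$, $F\subset E$, with $\mu(F)=\mu(E\setminus F)=\frac12\mu(E)$. A set $N\in\mathcal{A}$ is $\mu$-null if $\mu(A\cup N)=\mu(A)$ for every $A\in\mathcal{A}$; "$\mu$-almost all" means outside a $\mu$-null set. Choquet integral. For measurable $f:X\to[0,\infty)$, $\int_X^* f\,d\mu:=\int_0^\infty\mu(\{f>t\})\,dt$, and $f$ is (Choquet) integrable if this is finite. For $E\in\mathcal{A}$, $\mu_f(E)=\int_E^*f\,d\mu:=\int_X^*1_Ef\,d\mu$. For $f:X\to\mathbb{R}^n_+$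 (the closed positive orthant), integrals and integrability are understood componentwise; $\mu_f(E)$ is then a vector. $(\mathbb{R}^n_+)^\circ$ is the interior of $\mathbb{R}^n_+$. Economy. (E1) $\mu$ is a semiconvex submodular fuzzy measure on $(X,\mathcal{A})$ such that a countable union of sets of $\mu$-measure zero has $\mu$-measure zero, and there is a finite measurable partition $\{E_1,\dots,E_r\}$ of $X$ with $\mu(A)=\sum_{i=1}^r\mu(A\cap E_i)$ for all $A\in\mathcal{A}$. (E2) The commodity space is $\mathbb{R}^n$ and the consumption set of each agent is $\mathbb{R}^n_+$. (E3) The initial endowment $e:X\to(\mathbb{R}^n_+)^\circ$ is constant on each $E_i$, $e(a)=e_i$ for $a\in E_i$, and $\mu_e(X)\in(\mathbb{R}^n_+)^\circ$. Each agent $a\in X$ has a strict preference relation $\succ_a$ on $\mathbb{R}^n_+$. Equilibrium notions. An allocation is an integrable $f:X\to\mathbb{R}^n_+$; it is feasible if $\mu_f(X)=\mu_e(X)$. A price is $p\in\mathbb{R}^n_+\setminus\{0\}$; the budget set of $a\in E_i$ is $B_p(a)=\{x\in\mathbb{R}^n_+:p\cdot x\le p\cdot e_i\}$. A feasible allocation $f$ is walrasian ($f\in W(\mathcal{E})$) if there is a price $p$ such that for $\mu$-almost all $a\in X$: $f(a)\in B_p(a)$, and $x\succ_a f(a)$ implies $p\cdot x>p\cdot e(a)$. *)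

theory Defs
  imports "HOL-Analysis.Analysis" "HOL-Library.Disjoint_Sets"
begin

text \<open>
  The argument \<open>M :: 'a measure\<close> only serves as the measurable space
  \<open>(space M, sets M)\<close>; the measure it carries is never used. The fuzzy measure is a separate
  set function \<open>\<mu>\<close>, whose values outside \<open>sets M\<close> are irrelevant.
\<close>

definition fuzzy_measure :: "'a measure \<Rightarrow> ('a set \<Rightarrow> real) \<Rightarrow> bool" where
  "fuzzy_measure M \<mu> \<longleftrightarrow>
     \<mu> {} = 0 \<and> (\<forall>A\<in>sets M. 0 \<le> \<mu> A) \<and>
     (\<forall>A\<in>sets M. \<forall>B\<in>sets M. A \<subseteq> B \<longrightarrow> \<mu> A \<le> \<mu> B)"

definition submodular :: "'a measure \<Rightarrow> ('a set \<Rightarrow> real) \<Rightarrow> bool" where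
  "submodular M \<mu> \<longleftrightarrow>
     (\<forall>A\<in>sets M. \<forall>B\<in>sets M. \<mu> (A \<union> B) + \<mu> (A \<inter> B) \<le> \<mu> A + \<mu> B)"

definition semiconvex :: "'a measure \<Rightarrow> ('a set \<Rightarrow> real) \<Rightarrow> bool" where
  "semiconvex M \<mu> \<longleftrightarrow>
     (\<forall>A\<in>sets M. \<exists>F\<in>sets M. F \<subseteq> A \<and> \<mu> F = \<mu> A / 2 \<and> \<mu> (A - F) = \<mu> A / 2)"

definition fuzzy_null :: "'a measure \<Rightarrow> ('a set \<Rightarrow> real) \<Rightarrow> 'a set \<Rightarrow> bool" where
  "fuzzy_null M \<mu> N \<longleftrightarrow> N \<in> sets M \<and> (\<forall>A\<in>sets M. \<mu> (A \<union> N) = \<mu> A)"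

definition almost_all :: "'a measure \<Rightarrow> ('a set \<Rightarrow> real) \<Rightarrow> ('a \<Rightarrow> bool) \<Rightarrow> bool" where
  "almost_all M \<mu> P \<longleftrightarrow> (\<exists>N. fuzzy_null M \<mu> N \<and> (\<forall>a\<in>space M - N. P a))"

text \<open>
  The integrand \<open>t \<mapsto> \<mu> {f > t}\<close> is nonincreasing, so its Lebesgue integral is its improper
  Riemann integral. The integral is first taken with values in \<open>[0, \<infinity>]\<close>;
  \<open>choquet\<close> is its real value, meaningful when \<open>f\<close> is Choquet integrable.
\<close>

definition choquet_nn :: "'a measure \<Rightarrow> ('a set \<Rightarrow> real) \<Rightarrow> ('a \<Rightarrow> real) \<Rightarrow> ennreal" where
  "choquet_nn M \<mu> f = (\<integral>\<^sup>+t\<in>{0..}. ennreal (\<mu> {x \<in> space M. f x > t}) \<partial>lborel)"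

definition choquet :: "'a measure \<Rightarrow> ('a set \<Rightarrow> real) \<Rightarrow> ('a \<Rightarrow> real) \<Rightarrow> real" where
  "choquet M \<mu> f = enn2real (choquet_nn M \<mu> f)"

definition choquet_integrable :: "'a measure \<Rightarrow> ('a set \<Rightarrow> real) \<Rightarrow> ('a \<Rightarrow> real) \<Rightarrow> bool" where
  "choquet_integrable M \<mu> f \<longleftrightarrow>
     f \<in> borel_measurable M \<and> (\<forall>x\<in>space M. 0 \<le> f x) \<and> choquet_nn M \<mu> f < \<infinity>"

text \<open>The vector \<open>\<mu>\<^sub>f(E)\<close> of componentwise Choquet integrals over \<open>E\<close>.\<close>

definition choquet_vec ::
    "'a measure \<Rightarrow> ('a set \<Rightarrow> real) \<Rightarrow> ('a \<Rightarrow> real ^ 'n) \<Rightarrow> 'a set \<Rightarrow> real ^ 'n" where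
  "choquet_vec M \<mu> f E = (\<chi> j. choquet M \<mu> (\<lambda>x. indicator E x * f x $ j))"

definition orthant :: "(real ^ 'n) set" where
  "orthant = {x. \<forall>j. 0 \<le> x $ j}"

text \<open>
  The agents' preferences are subject to no general assumption and therefore are not a parameter
  of this locale.
\<close>

locale exchange_economy =
  fixes M :: "'a measure"
    and \<mu> :: "'a set \<Rightarrow> real"
    and r :: nat
    and E :: "nat \<Rightarrow> 'a set"
    and e :: "'a \<Rightarrow> real ^ 'n"
  assumes fuzzy: "fuzzy_measure M \<mu>"
    and submod: "submodular M \<mu>"
    and semiconv: "semiconvex M \<mu>"
    and zero_UN: "\<And>S :: nat \<Rightarrow> 'a set.
          (\<And>k. S k \<in> sets M \<and> \<mu> (S k) = 0) \<Longrightarrow> \<mu> (\<Union>k. S k) = 0"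
    and partition: "partition_on (space M) (E ` {1..r})"
    and distinct_blocks: "inj_on E {1..r}"
    and measurable_blocks: "\<And>i. i \<in> {1..r} \<Longrightarrow> E i \<in> sets M"
    and additive_blocks: "\<And>A. A \<in> sets M \<Longrightarrow> \<mu> A = (\<Sum>i=1..r. \<mu> (A \<inter> E i))"
    and endowment_interior: "\<And>a. a \<in> space M \<Longrightarrow> e a \<in> interior orthant"
    and endowment_constant: "\<And>i. i \<in> {1..r} \<Longrightarrow> e constant_on E i"
    and total_endowment: "choquet_vec M \<mu> e (space M) \<in> interior orthant"

definition allocation :: "'a measure \<Rightarrow> ('a set \<Rightarrow> real) \<Rightarrow> ('a \<Rightarrow> real ^ 'n) \<Rightarrow> bool" where
  "allocation M \<mu> f \<longleftrightarrow>
     (\<forall>a\<in>space M. f a \<in> orthant) \<and> (\<forall>j. choquet_integrable M \<mu> (\<lambda>a. f a $ j))"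

definition feasible ::
    "'a measure \<Rightarrow> ('a set \<Rightarrow> real) \<Rightarrow> ('a \<Rightarrow> real ^ 'n) \<Rightarrow> ('a \<Rightarrow> real ^ 'n) \<Rightarrow> bool" where
  "feasible M \<mu> e f \<longleftrightarrow> choquet_vec M \<mu> f (space M) = choquet_vec M \<mu> e (space M)"

definition price :: "real ^ 'n \<Rightarrow> bool" where
  "price p \<longleftrightarrow> p \<in> orthant - {0}"

definition budget_set :: "('a \<Rightarrow> real ^ 'n) \<Rightarrow> real ^ 'n \<Rightarrow> 'a \<Rightarrow> (real ^ 'n) set" where
  "budget_set e p a = {x \<in> orthant. p \<bullet> x \<le> p \<bullet> e a}"

text \<open>
  \<open>pref a x y\<close> means \<open>x \<succ>\<^sub>a y\<close>; only its values for \<open>x, y\<close> in the orthant matter.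
\<close>

definition walrasian ::
    "'a measure \<Rightarrow> ('a set \<Rightarrow> real) \<Rightarrow> ('a \<Rightarrow> real ^ 'n) \<Rightarrow>
     ('a \<Rightarrow> real ^ 'n \<Rightarrow> real ^ 'n \<Rightarrow> bool) \<Rightarrow> ('a \<Rightarrow> real ^ 'n) set" where
  "walrasian M \<mu> e pref =
     {f. allocation M \<mu> f \<and> feasible M \<mu> e f \<and>
         (\<exists>p. price p \<and>
            almost_all M \<mu> (\<lambda>a. f a \<in> budget_set e p a \<and>
              (\<forall>x\<in>orthant. pref a x (f a) \<longrightarrow> p \<bullet> x > p \<bullet> e a)))}"

end

theory Submission
  imports Defs
begin

text \<open>Choose a commodity \<open>j\<close> in all the \<open>J i\<close> and let the price be
  the \<open>j\<close>-th unit vector, so that a bundle costs the amount of \<open>j\<close> in it.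
  A bundle preferred to the endowment contains strictly more \<open>j\<close>, hence is too
  expensive. Feasibility of \<open>e\<close> is an identity, so what remains is that
  \<open>e\<close> is an allocation: its components are constant on finitely many measurable blocks,
  hence measurable and bounded, and a bounded measurable nonnegative function is Choquet integrable
  (\<open>choquet_integrable_bounded\<close>).\<close>

text \<open>Every preimage is a finite union of blocks, since a block meeting it lies wholly inside
  it.\<close>

lemma measurable_finite_partition_constant:
  assumes "finite I" and "space M = (\<Union>i\<in>I. A i)" and "\<And>i. i \<in> I \<Longrightarrow> A i \<in> sets M"
    and "\<And>i. i \<in> I \<Longrightarrow> f constant_on A i" and "\<And>a. a \<in> space M \<Longrightarrow> f a \<in> space N"
  shows "f \<in> measurable M N"
proof (rule measurableI)
  fix S
  have "f -` S \<inter> space M = (\<Union>i\<in>{i \<in> I. \<exists>a\<in>A i. f a \<in> S}. A i)"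
    using assms(2,4) unfolding constant_on_def by (auto, metis)
  also have "\<dots> \<in> sets M"
    using assms(1,3) by auto
  finally show "f -` S \<inter> space M \<in> sets M" .
qed (use assms in auto)

text \<open>The integrand \<open>\<mu> {f > t}\<close> is at most \<open>\<mu> (space M)\<close> by
  monotonicity and vanishes for \<open>t > K\<close>, where the level set is empty. A multiple of
  the indicator of \<open>{0..K}\<close> therefore dominates it.\<close>

lemma choquet_integrable_bounded:
  assumes "fuzzy_measure M \<mu>" and meas: "f \<in> borel_measurable M"
    and "\<And>x. x \<in> space M \<Longrightarrow> 0 \<le> f x" and bound: "\<And>x. x \<in> space M \<Longrightarrow> f x \<le> K"
  shows "choquet_integrable M \<mu> f"
proof -
  let ?S = "\<lambda>t. {x \<in> space M. f x > t}"
  have level: "?S t \<in> sets M" for t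
    using meas by measurable
  have "\<mu> {} = 0" and mono: "\<mu> (?S t) \<le> \<mu> (space M)" for t
    using assms(1) level[of t] sets.top[of M] unfolding fuzzy_measure_def by auto
  moreover have "?S t = {}" if "t > K" for t
    using bound that by force
  then have "\<mu> (?S t) = 0" if "t > K" for t
    using \<open>\<mu> {} = 0\<close> that by metis
  ultimately have pw: "ennreal (\<mu> (?S t)) * indicator {0..} t \<le> ennreal (\<mu> (space M)) * indicator {0..K} t"
    for t
    by (cases "t > K") (auto simp: indicator_def intro: ennreal_leI)
  have "choquet_nn M \<mu> f \<le> (\<integral>\<^sup>+t. ennreal (\<mu> (space M)) * indicator {0..K} t \<partial>lborel)"
    unfolding choquet_nn_def by (intro nn_integral_mono pw)
  also have "\<dots> = ennreal (\<mu> (space M)) * emeasure lborel {0..K}"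
    by (simp add: nn_integral_cmult_indicator)
  \<comment> \<open>A negative \<open>K\<close>, possible only on an empty space, is covered too:
    the interval is then empty and has measure 0.\<close>
  also have "\<dots> < \<infinity>"
    by (simp add: emeasure_lborel_Icc_eq ennreal_mult_less_top)
  finally show ?thesis
    using assms unfolding choquet_integrable_def by simp
qed

lemma (in exchange_economy) endowment_allocation: "allocation M \<mu> e"
proof -
  have space: "space M = (\<Union>i\<in>{1..r}. E i)"
    using partition by (auto simp: partition_on_def)
  have orthant: "e a \<in> orthant" if "a \<in> space M" for a
    using endowment_interior[OF that] interior_subset by blast
  \<comment> \<open>Each block contributes at most one value; finiteness makes the maximum below a
    legitimate bound for each component.\<close>
  have finite_image: "finite (e ` space M)"
  proof -
    have "finite (e ` E i)" if i: "i \<in> {1..r}" for i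
    proof -
      obtain c where "\<And>a. a \<in> E i \<Longrightarrow> e a = c"
        using endowment_constant[OF i] unfolding constant_on_def by auto
      then have "e ` E i \<subseteq> {c}"
        by blast
      then show ?thesis
        using finite_subset by blast
    qed
    then show ?thesis
      unfolding space image_UN by blast
  qed
  have "choquet_integrable M \<mu> (\<lambda>a. e a $ j)" for j
  proof (rule choquet_integrable_bounded[OF fuzzy])
    have "(\<lambda>a. e a $ j) constant_on E i" if "i \<in> {1..r}" for i
      using endowment_constant[OF that] unfolding constant_on_def by metis
    then show "(\<lambda>a. e a $ j) \<in> borel_measurable M"
      by (intro measurable_finite_partition_constant[OF _ space measurable_blocks]) auto
    show "0 \<le> e a $ j" if "a \<in> space M" for a
      using orthant[OF that] by (simp add: orthant_def)
    show "e a $ j \<le> Max ((\<lambda>x. x $ j) ` e ` space M)" if "a \<in> space M" for a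
      using finite_image that by (intro Max_ge) auto
  qed
  then show ?thesis
    using orthant by (simp add: allocation_def)
qed

text \<open>
  Every block desires more of a common commodity \<open>j\<close>. Pricing only that commodity,
  each agent can afford the endowment, while any preferred bundle contains strictly more of \<open>j\<close>
  and hence costs strictly more.
\<close>

theorem proposition3p12:
  fixes M :: "'a measure"
    and \<mu> :: "'a set \<Rightarrow> real"
    and r :: nat
    and E :: "nat \<Rightarrow> 'a set"
    and e :: "'a \<Rightarrow> real ^ 'n"
    and pref :: "'a \<Rightarrow> real ^ 'n \<Rightarrow> real ^ 'n \<Rightarrow> bool"
    and J :: "nat \<Rightarrow> 'n set"
  assumes "exchange_economy M \<mu> r E e"
    and "(\<Inter>i\<in>{1..r}. J i) \<noteq> {}"
    and "\<And>k a x y. k \<in> {1..r} \<Longrightarrow> a \<in> E k \<Longrightarrow> x \<in> orthant \<Longrightarrow> y \<in> orthant \<Longrightarrow>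
           pref a x y \<longleftrightarrow> (\<forall>j\<in>J k. x $ j > y $ j)"
  shows "e \<in> walrasian M \<mu> e pref"
proof -
  interpret exchange_economy M \<mu> r E e
    by fact
  obtain j where j: "\<And>i. i \<in> {1..r} \<Longrightarrow> j \<in> J i"
    using assms(2) by blast
  define p :: "real ^ 'n" where "p = axis j 1"
  have p_inner: "p \<bullet> x = x $ j" for x
    by (simp add: p_def inner_axis')
  have "price p"
    by (auto simp: price_def orthant_def p_def axis_def vec_eq_iff)
  \<comment> \<open>The exceptional set can be empty, because both equilibrium conditions are shown
    for every agent.\<close>
  moreover have "fuzzy_null M \<mu> {}"
    by (simp add: fuzzy_null_def)
  moreover have "e a \<in> budget_set e p a" if "a \<in> space M" for a
    using that endowment_allocation by (simp add: budget_set_def allocation_def)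
  moreover have "p \<bullet> x > p \<bullet> e a" if a: "a \<in> space M" and x: "x \<in> orthant" "pref a x (e a)" for a x
  proof -
    \<comment> \<open>The block of \<open>a\<close> determines which \<open>J k\<close> governs its
      preference; \<open>j\<close> belongs to it whichever block this is.\<close>
    obtain k where k: "k \<in> {1..r}" "a \<in> E k"
      using a partition unfolding partition_on_def by blast
    have "e a \<in> orthant"
      using a endowment_allocation by (simp add: allocation_def)
    then show ?thesis
      using assms(3)[OF k x(1)] x(2) j[OF k(1)] by (simp add: p_inner)
  qed
  ultimately have "\<exists>p. price p \<and> almost_all M \<mu> (\<lambda>a. e a \<in> budget_set e p a \<and>
      (\<forall>x\<in>orthant. pref a x (e a) \<longrightarrow> p \<bullet> x > p \<bullet> e a))"
    unfolding almost_all_def by blast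
  then show ?thesis
    using endowment_allocation by (simp add: walrasian_def feasible_def)
qed

end
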